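(* Let $\{(x_i,y_i)\}_{i=1}^6\subset\mathbb{P}^2\times\mathbb{P}^2$ be such that neither the $x_i$'s nor the $y_i$'s are in a line and $\{(x_i,y_i)\}_{i=1}^6$ is not an asymmetric double triangle. Let $Z_6$ be the $6\times9$ matrix with rows $x_i^\top\otimes y_i^\top$. Then $Z_6$ is rank deficient (i.e. $\operatorname{rank}(Z_6)<6$) if and only if either one of the inherited conditions holds or the bracket equations $$[ikp]_x[jrp]_x[irs]_y[jks]_y=[irp]_x[jkp]_x[iks]_y[jrs]_y$$ hold for all distinct indices $i,j,k,r,p,s\in\{1,2,3,4,5,6\}$ (up to permutations these are $30$ equations, one for each choice of $p$ and $s$).
   Context: $\mathbb{P}^2$ is the projective plane over $\mathbb{C}$; points are represented by nonzero column vectors and $\otimes$ is the Kronecker product. An inherited condition holds for $Z_6$ if the rows of $Z_6$ indexed by some proper subset of $\{1,\dots,6\}$ are linearly dependent. $[ijl]_x$ (respectively $[ijl]_y$) is the determinant of the $3\times3$ matrix with rows $x_i^\top,x_j^\top,x_l^\top$ (respectively $y_i^\top,y_j^\top,y_l^\top$). The configuration $\{(x_i,y_i)\}_{i=1}^6$ is an asymmetric double triangle if $\{x_i\}$ and $\{y_i\}$ each consist of $3$ distinct points such that, up to reordering, $y_1=y_2$, $y_3=y_4$, $y_5=y_6$, $x_1=x_4$, $x_2=x_5$, and $x_3=x_6$. *)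

theory Defs
  imports "HOL-Analysis.Analysis"
begin

text \<open>
  Points of the complex projective plane are given by nonzero representatives in \<open>complex ^ 3\<close>.
  Configurations are families indexed by the six-element type \<open>6\<close>, whose elements are
  \<open>1, 2, 3, 4, 5, 6\<close> (with \<open>6 = 0\<close>, as arithmetic in this type is modulo 6).
\<close>

text \<open>The projective point represented by \<open>v\<close>, i.e. the line through the origin that it spans.\<close>

definition proj_point :: "complex ^ 3 \<Rightarrow> (complex ^ 3) set" where
  "proj_point v = vec.span {v}"

text \<open>
  A line of the projective plane is the zero set of a nonzero linear form.  (The library's
  \<open>collinear\<close> is real affine collinearity.)
\<close>

definition in_a_line :: "('i \<Rightarrow> complex ^ 3) \<Rightarrow> bool" where
  "in_a_line x \<longleftrightarrow> (\<exists>a::complex ^ 3. a \<noteq> 0 \<and> (\<forall>i. (\<Sum>k\<in>UNIV. a $ k * x i $ k) = 0))"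

text \<open>
  Columns of Kronecker products of vectors are indexed by pairs instead of by \<open>(k - 1) * n + l\<close>.
\<close>

definition kronecker_vec :: "'a::times ^ 'm \<Rightarrow> 'a ^ 'n \<Rightarrow> 'a ^ ('m \<times> 'n)" where
  "kronecker_vec u v = (\<chi> kl. u $ fst kl * v $ snd kl)"

definition Z_matrix :: "('i \<Rightarrow> complex ^ 3) \<Rightarrow> ('i \<Rightarrow> complex ^ 3) \<Rightarrow> complex ^ (3 \<times> 3) ^ 'i" where
  "Z_matrix x y = (\<chi> i. kronecker_vec (x i) (y i))"

text \<open>
  Dependence of the rows as an indexed family: unlike for \<open>vec.dependent\<close> of the set of rows,
  two equal rows are dependent.
\<close>

definition rows_dependent :: "'a::field ^ 'n ^ 'm \<Rightarrow> 'm set \<Rightarrow> bool" where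
  "rows_dependent A I \<longleftrightarrow>
     (\<exists>c. (\<exists>i\<in>I. c i \<noteq> 0) \<and> (\<Sum>i\<in>I. c i *s row i A) = 0)"

definition inherited_condition :: "'a::field ^ 'n ^ 'm \<Rightarrow> bool" where
  "inherited_condition A \<longleftrightarrow> (\<exists>I. I \<subset> UNIV \<and> rows_dependent A I)"

definition bracket :: "('i \<Rightarrow> complex ^ 3) \<Rightarrow> 'i \<Rightarrow> 'i \<Rightarrow> 'i \<Rightarrow> complex" where
  "bracket x i j l = det (vector [x i, x j, x l] :: complex ^ 3 ^ 3)"

text \<open>The permutation \<open>\<sigma>\<close> is the reordering of the six pairs.\<close>

definition asymmetric_double_triangle :: "(6 \<Rightarrow> complex ^ 3) \<Rightarrow> (6 \<Rightarrow> complex ^ 3) \<Rightarrow> bool" where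
  "asymmetric_double_triangle x y \<longleftrightarrow>
     card (range (\<lambda>i. proj_point (x i))) = 3 \<and>
     card (range (\<lambda>i. proj_point (y i))) = 3 \<and>
     (\<exists>\<sigma>::6 \<Rightarrow> 6. bij \<sigma> \<and>
        proj_point (y (\<sigma> 1)) = proj_point (y (\<sigma> 2)) \<and>
        proj_point (y (\<sigma> 3)) = proj_point (y (\<sigma> 4)) \<and>
        proj_point (y (\<sigma> 5)) = proj_point (y (\<sigma> 6)) \<and>
        proj_point (x (\<sigma> 1)) = proj_point (x (\<sigma> 4)) \<and>
        proj_point (x (\<sigma> 2)) = proj_point (x (\<sigma> 5)) \<and>
        proj_point (x (\<sigma> 3)) = proj_point (x (\<sigma> 6)))"

end

theory Submission
  imports Defs
begin

text \<open>
  A vector \<open>m\<close> of \<open>\<complex>\<^sup>9\<close> is read as the bilinear form that sends \<open>(u, v)\<close> to its pairing with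
  the Kronecker product of \<open>u\<close> and \<open>v\<close>.  The forms that vanish at all six pairs \<open>(x\<^sub>i, y\<^sub>i)\<close> are the
  annihilator \<open>L\<close> of the rows of \<open>Z\<^sub>6\<close>; if the rows are independent, \<open>L\<close> has dimension \<open>3\<close>.

  If the rows are dependent but no proper subfamily is, all coefficients of a relation are nonzero.
  Pairing the relation with the product of a linear form vanishing at \<open>x\<^sub>i, x\<^sub>p\<close> and one vanishing
  at \<open>y\<^sub>j, y\<^sub>s\<close> kills four of the six terms.  Two such two-term relations have the common nonzero
  solution \<open>(c\<^sub>k, c\<^sub>r)\<close>, and the vanishing of their determinant is the bracket equation
  (\<open>bracket_equation_if_circuit\<close>).

  Conversely, project the remaining four pairs from \<open>x\<^sub>p\<close> and from \<open>y\<^sub>s\<close>.  The bracket equation says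
  that the two resulting quadruples on a projective line have the same cross-ratio, that is, that
  the four products in \<open>\<complex>\<^sup>2 \<otimes> \<complex>\<^sup>2\<close> are dependent.  A form vanishing on them pulls back to a nonzero
  \<open>m \<in> L\<close> with \<open>m(x\<^sub>p, _) = 0\<close> and \<open>m(_, y\<^sub>s) = 0\<close>
  (\<open>has_singular_forms_if_bracket_equations\<close>).  Letting \<open>s\<close> vary shows, as the \<open>y\<^sub>i\<close>
  are not in a line, that the forms of \<open>L\<close> with \<open>m(x\<^sub>p, _) = 0\<close> make up a space of dimension at least \<open>2\<close>
  (\<open>two_independent_forms_vanishing_at\<close>).

  Suppose now that the rows are independent.  Since \<open>dim L = 3\<close>, all the linear forms \<open>m(x\<^sub>p, _)\<close>
  with \<open>m \<in> L\<close> are proportional, by symmetry so are all the \<open>m(_, y\<^sub>s)\<close>, and for any \<open>p, q\<close> some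
  nonzero \<open>m \<in> L\<close> satisfies \<open>m(x\<^sub>p, _) = m(x\<^sub>q, _) = 0\<close>.  Take three of the \<open>x\<^sub>i\<close> as a basis, with
  dual basis \<open>\<alpha>\<^sub>a\<close>.  A form \<open>m\<^sub>a \<in> L\<close> that vanishes at the two basis points other than the \<open>a\<close>-th
  has rank one, \<open>m\<^sub>a(u, v) = \<alpha>\<^sub>a(u) r\<^sub>a(v)\<close>.  Proportionality at \<open>y\<^sub>i\<close> leaves at most one \<open>a\<close> with
  \<open>r\<^sub>a(y\<^sub>i) \<noteq> 0\<close>, and proportionality at \<open>x\<^sub>i\<close> then leaves only one \<open>a\<close> with \<open>\<alpha>\<^sub>a(x\<^sub>i) \<noteq> 0\<close>.
  So each \<open>x\<^sub>i\<close> is one of three points and each \<open>y\<^sub>i\<close> is one of three points, and the labels of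
  \<open>x\<^sub>i\<close> and \<open>y\<^sub>i\<close> differ because \<open>m\<^sub>a(x\<^sub>i, y\<^sub>i) = 0\<close> (\<open>triangle_labels\<close>).  The six pairs of
  labels are distinct, as equal labels give proportional rows, so they are all six off-diagonal
  cells of a \<open>3 \<times> 3\<close> grid; this is an
  asymmetric double triangle.
\<close>

section \<open>Rank and dependent families\<close>

lemma dependent_family_if_dim_less:
  fixes m :: "'n::finite \<Rightarrow> 'a::field ^ 'k"
  assumes "\<And>i. m i \<in> S" and "vec.dim S < CARD('n)"
  shows "\<exists>c. (\<exists>i. c i \<noteq> 0) \<and> (\<Sum>i\<in>UNIV. c i *s m i) = 0"
proof (rule ccontr)
  assume no: "\<not> ?thesis"
  define A :: "'a ^ 'n ^ 'k" where "A = (\<chi> k i. m i $ k)"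
  have A: "A *v c = (\<Sum>i\<in>UNIV. c $ i *s m i)" for c
    by (simp add: matrix_mult_sum column_def A_def)
  have "c = 0" if "A *v c = 0" for c
    using no that by (auto simp: A vec_eq_iff)
  then have "inj ((*v) A)"
    by (simp add: vec.inj_iff_eq_0)
  then have "vec.dim (range ((*v) A)) = vec.dim (UNIV :: ('a ^ 'n) set)"
    by (intro vec.dim_image_eq) (auto intro: inj_on_subset)
  then have "vec.dim (range ((*v) A)) = CARD('n)"
    by (simp only: vec_dim_card)
  moreover have "A *v c \<in> vec.span S" for c
    unfolding A using assms(1) by (intro vec.span_sum vec.span_scale vec.span_base)
  then have "vec.dim (range ((*v) A)) \<le> vec.dim S"
    by (intro vec.dim_subset[of _ "vec.span S", unfolded vec.dim_span]) auto
  ultimately show False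
    using assms(2) by simp
qed

lemma rank_less_iff_rows_dependent:
  fixes A :: "'a::field ^ 'n ^ 'm"
  shows "rank A < CARD('m) \<longleftrightarrow> rows_dependent A UNIV"
proof
  assume "rank A < CARD('m)"
  moreover have "row i A \<in> rows A" for i
    by (auto simp: rows_def)
  ultimately show "rows_dependent A UNIV"
    unfolding rows_dependent_def row_rank_def_gen
    using dependent_family_if_dim_less[of "\<lambda>i. row i A" "rows A"] by auto
next
  assume "rows_dependent A UNIV"
  then obtain c j where c: "c j \<noteq> 0" "(\<Sum>i\<in>UNIV. c i *s row i A) = 0"
    by (auto simp: rows_dependent_def)
  let ?W = "(\<lambda>i. row i A) ` (UNIV - {j})"
  have "(\<Sum>i\<in>UNIV. c i *s row i A) = c j *s row j A + (\<Sum>i\<in>UNIV - {j}. c i *s row i A)"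
    by (simp add: sum.remove)
  with c have "c j *s row j A = - (\<Sum>i\<in>UNIV - {j}. c i *s row i A)"
    by (simp add: eq_neg_iff_add_eq_0)
  also have "\<dots> \<in> vec.span ?W"
    by (intro vec.span_neg vec.span_sum vec.span_scale vec.span_base) auto
  finally have "inverse (c j) *s (c j *s row j A) \<in> vec.span ?W"
    by (rule vec.span_scale)
  then have "row j A \<in> vec.span ?W"
    using c(1) by simp
  moreover have "row i A \<in> vec.span ?W" if "i \<noteq> j" for i
    using that by (intro vec.span_base) auto
  ultimately have "row i A \<in> vec.span ?W" for i
    by (cases "i = j") auto
  then have "rows A \<subseteq> vec.span ?W"
    by (auto simp: rows_def)
  then have "rank A \<le> card ?W"
    unfolding row_rank_def_gen by (rule vec.dim_le_card) simp
  also have "\<dots> \<le> CARD('m) - 1"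
    using card_image_le[of "UNIV - {j}" "\<lambda>i. row i A"] by simp
  finally show "rank A < CARD('m)"
    using zero_less_card_finite[where 'a = 'm] by linarith
qed

text \<open>
  A right inverse of \<open>A\<close> embeds \<open>'a ^ 'm\<close> into a subspace that meets the kernel only in \<open>0\<close>.
\<close>

lemma dim_kernel_le:
  fixes A :: "'a::field ^ 'n ^ 'm"
  assumes "\<not> rows_dependent A UNIV"
  shows "vec.dim {v. A *v v = 0} + CARD('m) \<le> CARD('n)"
proof -
  have "\<forall>c. (\<Sum>i\<in>UNIV. c i *s row i A) = 0 \<longrightarrow> (\<forall>i. c i = 0)"
    using assms by (auto simp: rows_dependent_def)
  then obtain B where B: "A ** B = mat 1"
    unfolding matrix_right_invertible_independent_rows[symmetric] by (elim exE)
  then have AB: "A *v (B *v c) = c" for c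
    by (simp add: matrix_vector_mul_assoc)
  then have "inj ((*v) B)"
    by (metis injI)
  then have "vec.dim (range ((*v) B)) = vec.dim (UNIV :: ('a ^ 'm) set)"
    by (intro vec.dim_image_eq) (auto intro: inj_on_subset)
  then have "vec.dim (range ((*v) B)) = CARD('m)"
    by (simp only: vec_dim_card)
  moreover have "range ((*v) B) \<inter> {v. A *v v = 0} = {0}"
  proof (intro equalityI subsetI)
    fix v
    assume "v \<in> range ((*v) B) \<inter> {v. A *v v = 0}"
    then obtain c where "v = B *v c" "A *v v = 0"
      by auto
    then show "v \<in> {0}"
      using AB[of c] by simp
  next
    fix v :: "'a ^ 'n"
    assume "v \<in> {0}"
    then show "v \<in> range ((*v) B) \<inter> {v. A *v v = 0}"
      by (auto intro: range_eqI[of _ _ 0])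
  qed
  moreover have "vec.subspace (range ((*v) B))"
    by (rule vec.linear_subspace_image[OF matrix_vector_mul_linear_gen vec.subspace_UNIV])
  moreover have "vec.subspace {v. A *v v = 0}"
    by (auto intro!: vec.subspaceI simp: matrix_vector_right_distrib vector_scalar_commute)
  ultimately show ?thesis
    using vec.dim_sums_Int[of "range ((*v) B)" "{v. A *v v = 0}"]
      vec.dim_subset[OF subset_UNIV, of "{u + v |u v. u \<in> range ((*v) B) \<and> v \<in> {v. A *v v = 0}}"]
    unfolding vec_dim_card by simp
qed

section \<open>Vectors of the Kronecker product as bilinear forms\<close>

notation scalar_product (infix "\<odot>" 70)
notation kronecker_vec (infix "\<otimes>" 75)

lemma scalar_product_add_left: "(a + b) \<odot> u = a \<odot> u + b \<odot> u"
  and scalar_product_smult_left: "(c *s a) \<odot> u = c * (a \<odot> u)"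
  and scalar_product_add_right: "a \<odot> (u + v) = a \<odot> u + a \<odot> v"
  and scalar_product_smult_right: "a \<odot> (c *s u) = c * (a \<odot> u)"
  and scalar_product_diff_left: "(a - b) \<odot> u = a \<odot> u - b \<odot> u"
  and scalar_product_diff_right: "a \<odot> (u - v) = a \<odot> u - a \<odot> v"
  and scalar_product_zero_left: "0 \<odot> u = 0"
  for a b u v :: "'a::comm_ring_1 ^ 'n"
  by (simp_all add: scalar_product_def algebra_simps sum.distrib sum_subtractf sum_distrib_left)

lemma kronecker_vec_add_left: "(u + u') \<otimes> v = u \<otimes> v + u' \<otimes> v"
  and kronecker_vec_smult_left: "(c *s u) \<otimes> v = c *s (u \<otimes> v)"
  and kronecker_vec_smult_right: "u \<otimes> (c *s v) = c *s (u \<otimes> v)"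
  for u u' :: "'a::comm_ring_1 ^ 'm" and v :: "'a ^ 'n"
  by (simp_all add: kronecker_vec_def vec_eq_iff algebra_simps)

lemma scalar_product_kronecker:
  fixes a u :: "'a::comm_ring_1 ^ 'm" and b v :: "'a ^ 'n"
  shows "(a \<otimes> b) \<odot> (u \<otimes> v) = (a \<odot> u) * (b \<odot> v)"
proof -
  have "(a \<otimes> b) \<odot> (u \<otimes> v) = (\<Sum>k\<in>UNIV. \<Sum>l\<in>UNIV. (a $ k * u $ k) * (b $ l * v $ l))"
    unfolding scalar_product_def kronecker_vec_def
    by (simp add: sum.cartesian_product algebra_simps case_prod_unfold)
  then show ?thesis
    by (simp add: scalar_product_def sum_product)
qed

text \<open>
  The linear form that is left when the first argument of the bilinear form \<open>m\<close> is fixed to \<open>u\<close>.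
\<close>

definition contract_left :: "'a::comm_ring_1 ^ ('m::finite \<times> 'n::finite) \<Rightarrow> 'a ^ 'm \<Rightarrow> 'a ^ 'n" where
  "contract_left m u = (\<chi> l. \<Sum>k\<in>UNIV. m $ (k, l) * u $ k)"

lemma scalar_product_contract_left: "contract_left m u \<odot> v = m \<odot> (u \<otimes> v)"
proof -
  have "m \<odot> (u \<otimes> v) = (\<Sum>k\<in>UNIV. \<Sum>l\<in>UNIV. m $ (k, l) * u $ k * v $ l)"
    unfolding scalar_product_def kronecker_vec_def
    by (simp add: sum.cartesian_product algebra_simps case_prod_unfold)
  also have "\<dots> = (\<Sum>l\<in>UNIV. \<Sum>k\<in>UNIV. m $ (k, l) * u $ k * v $ l)"
    by (rule sum.swap)
  finally show ?thesis
    by (simp add: scalar_product_def contract_left_def sum_distrib_right)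
qed

text \<open>
  Exchanging the arguments of the form carries statements about the \<open>x\<^sub>i\<close> over to the \<open>y\<^sub>i\<close>.
\<close>

definition flip :: "'a ^ ('m::finite \<times> 'n::finite) \<Rightarrow> 'a ^ ('n \<times> 'm)" where
  "flip m = (\<chi> lk. m $ (snd lk, fst lk))"

lemma scalar_product_flip: "flip m \<odot> (v \<otimes> u) = m \<odot> (u \<otimes> v)"
  for m :: "'a::comm_ring_1 ^ ('m::finite \<times> 'n::finite)"
proof -
  have "m \<odot> (u \<otimes> v) = (\<Sum>kl\<in>UNIV. m $ (snd (prod.swap kl), fst (prod.swap kl)) *
      (v $ fst (prod.swap kl) * u $ snd (prod.swap kl)))"
    unfolding scalar_product_def kronecker_vec_def by (simp add: ac_simps)
  also have "\<dots> = (\<Sum>lk\<in>UNIV. m $ (snd lk, fst lk) * (v $ fst lk * u $ snd lk))"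
    by (rule sum.reindex_bij_betw) simp
  finally show ?thesis
    by (simp add: scalar_product_def kronecker_vec_def flip_def)
qed

lemma scalar_product_axis: "a \<odot> axis k 1 = a $ k" for a :: "'a::comm_ring_1 ^ 'n"
  by (simp add: scalar_product_def axis_def if_distrib[of "\<lambda>t. _ * t"] cong: if_cong)

lemma eq_0_if_kills_kronecker:
  fixes m :: "'a::comm_ring_1 ^ ('m::finite \<times> 'n::finite)"
  assumes "\<And>u v. m \<odot> (u \<otimes> v) = 0"
  shows "m = 0"
proof -
  have "m $ (k, l) = 0" for k l
  proof -
    have "m $ (k, l) = contract_left m (axis k 1) \<odot> axis l 1"
      unfolding scalar_product_axis
      by (simp add: contract_left_def axis_def if_distrib[of "\<lambda>t. _ * t"] cong: if_cong)
    then show ?thesis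
      by (simp add: scalar_product_contract_left assms)
  qed
  then show ?thesis
    by (auto simp: vec_eq_iff)
qed

lemma not_in_a_lineD:
  assumes "\<not> in_a_line x" and "\<And>i. a \<odot> x i = 0"
  shows "a = 0"
  using assms unfolding in_a_line_def scalar_product_def by blast

lemma scalar_product_3: "a \<odot> u = a $ 1 * u $ 1 + a $ 2 * u $ 2 + a $ 3 * u $ 3" for a :: "complex ^ 3"
  by (simp add: scalar_product_def sum_3)

section \<open>Projections and cross-ratios\<close>

lemma det_4:
  "det (A::'a::comm_ring_1^4^4) =
    A$1$1 * A$2$2 * A$3$3 * A$4$4 +
    A$1$1 * A$2$3 * A$3$4 * A$4$2 +
    A$1$1 * A$2$4 * A$3$2 * A$4$3 +
    A$1$2 * A$2$1 * A$3$4 * A$4$3 +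
    A$1$2 * A$2$3 * A$3$1 * A$4$4 +
    A$1$2 * A$2$4 * A$3$3 * A$4$1 +
    A$1$3 * A$2$1 * A$3$2 * A$4$4 +
    A$1$3 * A$2$2 * A$3$4 * A$4$1 +
    A$1$3 * A$2$4 * A$3$1 * A$4$2 +
    A$1$4 * A$2$1 * A$3$3 * A$4$2 +
    A$1$4 * A$2$2 * A$3$1 * A$4$3 +
    A$1$4 * A$2$3 * A$3$2 * A$4$1 -
    A$1$1 * A$2$2 * A$3$4 * A$4$3 -
    A$1$1 * A$2$3 * A$3$2 * A$4$4 -
    A$1$1 * A$2$4 * A$3$3 * A$4$2 -
    A$1$2 * A$2$1 * A$3$3 * A$4$4 -
    A$1$2 * A$2$3 * A$3$4 * A$4$1 -
    A$1$2 * A$2$4 * A$3$1 * A$4$3 -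
    A$1$3 * A$2$1 * A$3$4 * A$4$2 -
    A$1$3 * A$2$2 * A$3$1 * A$4$4 -
    A$1$3 * A$2$4 * A$3$2 * A$4$1 -
    A$1$4 * A$2$1 * A$3$2 * A$4$3 -
    A$1$4 * A$2$2 * A$3$3 * A$4$1 -
    A$1$4 * A$2$3 * A$3$1 * A$4$2"
proof -
  have f1234: "finite {2::4, 3, 4}" "1 \<notin> {2::4, 3, 4}"
    by auto
  have f234: "finite {3::4, 4}" "2 \<notin> {3::4, 4}"
    by auto
  have f34: "finite {4::4}" "3 \<notin> {4::4}"
    by auto
  show ?thesis
    unfolding det_def UNIV_4
    unfolding sum_over_permutations_insert[OF f1234]
    unfolding sum_over_permutations_insert[OF f234]
    unfolding sum_over_permutations_insert[OF f34]
    unfolding permutes_sing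
    by (simp add: sign_swap_id permutation_swap_id permutation_compose sign_compose sign_id swap_id_eq)
qed

text \<open>
  Linear projection from the point \<open>x\<close> onto a projective line, in coordinates \<open>\<phi>, \<psi>\<close>.  Up to the
  factor \<open>l\<close>, brackets that contain \<open>x\<close> become \<open>2 \<times> 2\<close> determinants of projected points.
\<close>

lemma projection_from_point:
  fixes x :: "complex ^ 3"
  assumes "x \<noteq> 0"
  obtains \<phi> \<psi> :: "complex ^ 3" and l where "\<phi> \<odot> x = 0" "\<psi> \<odot> x = 0" "l \<noteq> 0"
    "\<And>u v. (\<phi> \<odot> u) * (\<psi> \<odot> v) - (\<psi> \<odot> u) * (\<phi> \<odot> v) = l * det (vector [u, v, x] :: complex ^ 3 ^ 3)"
    "\<And>a b. \<exists>u. \<phi> \<odot> u = a \<and> \<psi> \<odot> u = b"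
proof -
  note [simp] = scalar_product_3 det_3
  consider "x $ 1 \<noteq> 0" | "x $ 2 \<noteq> 0" | "x $ 3 \<noteq> 0"
    using assms by (auto simp: vec_eq_iff forall_3)
  then show thesis
  proof cases
    case 1
    show ?thesis
    proof (rule that[of "vector [- x $ 2, x $ 1, 0]" "vector [- x $ 3, 0, x $ 1]" "x $ 1"])
      show "\<exists>u. (vector [- x $ 2, x $ 1, 0] :: complex ^ 3) \<odot> u = a \<and> (vector [- x $ 3, 0, x $ 1] :: complex ^ 3) \<odot> u = b" for a b
        using 1 by (intro exI[of _ "vector [0, a / x $ 1, b / x $ 1]"]) simp
    qed (use 1 in \<open>simp_all add: algebra_simps\<close>)
  next
    case 2
    show ?thesis
    proof (rule that[of "vector [0, - x $ 3, x $ 2]" "vector [x $ 2, - x $ 1, 0]" "x $ 2"])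
      show "\<exists>u. (vector [0, - x $ 3, x $ 2] :: complex ^ 3) \<odot> u = a \<and> (vector [x $ 2, - x $ 1, 0] :: complex ^ 3) \<odot> u = b" for a b
        using 2 by (intro exI[of _ "vector [b / x $ 2, 0, a / x $ 2]"]) simp
    qed (use 2 in \<open>simp_all add: algebra_simps\<close>)
  next
    case 3
    show ?thesis
    proof (rule that[of "vector [x $ 3, 0, - x $ 1]" "vector [0, x $ 3, - x $ 2]" "x $ 3"])
      show "\<exists>u. (vector [x $ 3, 0, - x $ 1] :: complex ^ 3) \<odot> u = a \<and> (vector [0, x $ 3, - x $ 2] :: complex ^ 3) \<odot> u = b" for a b
        using 3 by (intro exI[of _ "vector [a / x $ 3, b / x $ 3, 0]"]) simp
    qed (use 3 in \<open>simp_all add: algebra_simps\<close>)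
  qed
qed

text \<open>
  The hypothesis is the equality, cleared of denominators, of the cross-ratios of the points
  \<open>(a\<^sub>n : b\<^sub>n)\<close> and of the points \<open>(c\<^sub>n : d\<^sub>n)\<close>.  Its two sides differ by the determinant of the
  four equations on the coefficients of the form.  This remains true when points coincide or
  coordinates vanish, so that no case has to be set apart.
\<close>

lemma bilinear_form_through_four_points:
  fixes a b c d :: "4 \<Rightarrow> complex"
  assumes "(a 1 * b 3 - b 1 * a 3) * (a 2 * b 4 - b 2 * a 4) * (c 1 * d 4 - d 1 * c 4) * (c 2 * d 3 - d 2 * c 3) =
    (a 1 * b 4 - b 1 * a 4) * (a 2 * b 3 - b 2 * a 3) * (c 1 * d 3 - d 1 * c 3) * (c 2 * d 4 - d 2 * c 4)"
  obtains m1 m2 m3 m4 where "m1 \<noteq> 0 \<or> m2 \<noteq> 0 \<or> m3 \<noteq> 0 \<or> m4 \<noteq> 0"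
    "\<And>n. m1 * (a n * c n) + m2 * (a n * d n) + m3 * (b n * c n) + m4 * (b n * d n) = 0"
proof -
  define N :: "complex ^ 4 ^ 4" where
    "N = (\<chi> n. vector [a n * c n, a n * d n, b n * c n, b n * d n])"
  have N: "N $ n $ 1 = a n * c n" "N $ n $ 2 = a n * d n" "N $ n $ 3 = b n * c n" "N $ n $ 4 = b n * d n" for n
    by (simp_all add: N_def vector_def)
  have "det N =
    (a 1 * b 4 - b 1 * a 4) * (a 2 * b 3 - b 2 * a 3) * (c 1 * d 3 - d 1 * c 3) * (c 2 * d 4 - d 2 * c 4) -
    (a 1 * b 3 - b 1 * a 3) * (a 2 * b 4 - b 2 * a 4) * (c 1 * d 4 - d 1 * c 4) * (c 2 * d 3 - d 2 * c 3)"
    unfolding det_4 N by (simp add: algebra_simps)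
  then have "\<not> invertible N"
    using assms by (simp add: invertible_det_nz)
  then obtain m where m: "m \<noteq> 0" "N *v m = 0"
    using matrix_left_invertible_ker[of N] invertible_left_inverse[of N] by blast
  have "(N *v m) $ n = 0" for n
    using m(2) by simp
  with m(1) show thesis
    by (intro that[of "m $ 1" "m $ 2" "m $ 3" "m $ 4"])
      (auto simp: vec_eq_iff forall_4 matrix_vector_mult_def sum_4 N algebra_simps)
qed

section \<open>Forms that vanish on the configuration\<close>

definition annihilator :: "('i \<Rightarrow> complex ^ 3) \<Rightarrow> ('i \<Rightarrow> complex ^ 3) \<Rightarrow> (complex ^ (3 \<times> 3)) set" where
  "annihilator x y = {m. \<forall>i. m \<odot> (x i \<otimes> y i) = 0}"

lemma annihilator_eq_kernel: "annihilator x y = {m. Z_matrix x y *v m = 0}"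
  by (simp add: annihilator_def Z_matrix_def matrix_vector_mult_def scalar_product_def vec_eq_iff mult.commute)

lemma four_forms_dependent:
  fixes x y :: "6 \<Rightarrow> complex ^ 3"
  assumes "\<not> rows_dependent (Z_matrix x y) UNIV"
    and "m1 \<in> annihilator x y" "m2 \<in> annihilator x y" "m3 \<in> annihilator x y" "m4 \<in> annihilator x y"
  obtains a b c d where "a \<noteq> 0 \<or> b \<noteq> 0 \<or> c \<noteq> 0 \<or> d \<noteq> 0"
    "a *s m1 + b *s m2 + c *s m3 + d *s m4 = 0"
proof -
  have "vec.dim (annihilator x y) < CARD(4)"
    using dim_kernel_le[OF assms(1)] by (simp add: annihilator_eq_kernel)
  moreover have "(vector [m1, m2, m3, m4] :: (complex ^ (3 \<times> 3)) ^ 4) $ i \<in> annihilator x y" for i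
    using exhaust_4[of i] assms(2-) by (auto simp: vector_def)
  ultimately obtain f where "\<exists>i. f i \<noteq> 0"
    "(\<Sum>i\<in>UNIV. f i *s (vector [m1, m2, m3, m4] :: (complex ^ (3 \<times> 3)) ^ 4) $ i) = 0"
    using dependent_family_if_dim_less[of "\<lambda>i. (vector [m1, m2, m3, m4] :: (complex ^ (3 \<times> 3)) ^ 4) $ i" "annihilator x y"]
    by blast
  then show thesis
    by (intro that[of "f 1" "f 2" "f 3" "f 4"]) (simp_all add: sum_4 vector_def, metis exhaust_4)
qed

text \<open>
  What the bracket equations amount to: each equation, with its \<open>p\<close> and \<open>s\<close>, provides one form.
\<close>

definition has_singular_forms :: "('i \<Rightarrow> complex ^ 3) \<Rightarrow> ('i \<Rightarrow> complex ^ 3) \<Rightarrow> bool" where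
  "has_singular_forms x y \<longleftrightarrow> (\<forall>p s. p \<noteq> s \<longrightarrow>
     (\<exists>m\<in>annihilator x y. m \<noteq> 0 \<and> (\<forall>v. m \<odot> (x p \<otimes> v) = 0) \<and> (\<forall>u. m \<odot> (u \<otimes> y s) = 0)))"

lemma flip_in_annihilator_iff: "flip m \<in> annihilator y x \<longleftrightarrow> m \<in> annihilator x y"
  by (simp add: annihilator_def scalar_product_flip)

lemma flip_eq_0_iff: "flip m = 0 \<longleftrightarrow> m = 0"
  by (auto simp: flip_def vec_eq_iff)

lemma has_singular_forms_swap:
  assumes "has_singular_forms x y"
  shows "has_singular_forms y x"
  unfolding has_singular_forms_def
proof (intro allI impI)
  fix p s :: 'a
  assume "p \<noteq> s"
  then obtain m where "m \<in> annihilator x y" "m \<noteq> 0" "\<forall>v. m \<odot> (x s \<otimes> v) = 0" "\<forall>u. m \<odot> (u \<otimes> y p) = 0"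
    using assms unfolding has_singular_forms_def by metis
  then show "\<exists>m\<in>annihilator y x. m \<noteq> 0 \<and> (\<forall>v. m \<odot> (y p \<otimes> v) = 0) \<and> (\<forall>u. m \<odot> (u \<otimes> x s) = 0)"
    by (intro bexI[of _ "flip m"]) (auto simp: flip_in_annihilator_iff flip_eq_0_iff scalar_product_flip)
qed

lemma rows_dependent_swap:
  fixes x y :: "'i::finite \<Rightarrow> complex ^ 3"
  assumes "rows_dependent (Z_matrix x y) UNIV"
  shows "rows_dependent (Z_matrix y x) UNIV"
proof -
  have "row i (Z_matrix x y) $ (k, l) = row i (Z_matrix y x) $ (l, k)" for i k l
    by (simp add: row_def Z_matrix_def kronecker_vec_def)
  then show ?thesis
    using assms unfolding rows_dependent_def by (simp add: vec_eq_iff) metis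
qed

lemma remaining_four:
  fixes p s :: 6
  assumes "p \<noteq> s"
  obtains i j k r where "distinct [i, j, k, r, p, s]"
proof -
  obtain xs where xs: "set xs = UNIV - {p, s}" "distinct xs"
    using finite_distinct_list[of "UNIV - {p, s}"] by auto
  have "length xs = 4"
    using distinct_card[OF xs(2)] assms by (simp add: xs(1) card_Diff_subset)
  then obtain i j k r where "xs = [i, j, k, r]"
    by (auto simp: numeral_eq_Suc length_Suc_conv)
  with xs assms that[of i j k r] show thesis
    by auto
qed

lemma UNIV_6_if_distinct:
  fixes i j k r p s :: 6
  assumes "distinct [i, j, k, r, p, s]"
  shows "UNIV = {i, j, k, r, p, s}"
proof -
  have "card {i, j, k, r, p, s} = 6"
    using distinct_card[OF assms] by simp
  then show ?thesis
    using card_subset_eq[of "UNIV :: 6 set" "{i, j, k, r, p, s}"] by simp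
qed

text \<open>
  The form on the two projective lines is pulled back along the projections from \<open>x\<^sub>p\<close> and \<open>y\<^sub>s\<close>.
  The pull-back vanishes at the pairs \<open>p\<close> and \<open>s\<close> by itself.
\<close>

lemma has_singular_forms_if_bracket_equations:
  fixes x y :: "6 \<Rightarrow> complex ^ 3"
  assumes "\<And>i. x i \<noteq> 0" and "\<And>i. y i \<noteq> 0"
    and "\<And>i j k r p s. distinct [i, j, k, r, p, s] \<Longrightarrow>
       bracket x i k p * bracket x j r p * bracket y i r s * bracket y j k s =
       bracket x i r p * bracket x j k p * bracket y i k s * bracket y j r s"
  shows "has_singular_forms x y"
  unfolding has_singular_forms_def
proof (intro allI impI)
  fix p s :: 6
  assume "p \<noteq> s"
  then obtain i j k r where d: "distinct [i, j, k, r, p, s]"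
    by (rule remaining_four)
  obtain \<phi> \<psi> :: "complex ^ 3" and l where \<phi>: "\<phi> \<odot> x p = 0" "\<psi> \<odot> x p = 0" "l \<noteq> 0"
    "\<And>u v. (\<phi> \<odot> u) * (\<psi> \<odot> v) - (\<psi> \<odot> u) * (\<phi> \<odot> v) = l * det (vector [u, v, x p] :: complex ^ 3 ^ 3)"
    "\<And>a b. \<exists>u. \<phi> \<odot> u = a \<and> \<psi> \<odot> u = b"
    by (rule projection_from_point[OF assms(1)[of p]]) (rule that)
  obtain \<phi>' \<psi>' :: "complex ^ 3" and l' where \<phi>': "\<phi>' \<odot> y s = 0" "\<psi>' \<odot> y s = 0" "l' \<noteq> 0"
    "\<And>u v. (\<phi>' \<odot> u) * (\<psi>' \<odot> v) - (\<psi>' \<odot> u) * (\<phi>' \<odot> v) = l' * det (vector [u, v, y s] :: complex ^ 3 ^ 3)"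
    "\<And>a b. \<exists>u. \<phi>' \<odot> u = a \<and> \<psi>' \<odot> u = b"
    by (rule projection_from_point[OF assms(2)[of s]]) (rule that)
  define g :: "4 \<Rightarrow> 6" where "g n = (if n = 1 then i else if n = 2 then j else if n = 3 then k else r)" for n
  have g: "g 1 = i" "g 2 = j" "g 3 = k" "g 4 = r"
    by (simp_all add: g_def)
  \<comment> \<open>Both sides contain \<open>p\<close> and \<open>s\<close> twice each, so both pick up the same factors.\<close>
  have "l * l * l' * l' * (bracket x i k p * bracket x j r p * bracket y i r s * bracket y j k s) =
    l * l * l' * l' * (bracket x i r p * bracket x j k p * bracket y i k s * bracket y j r s)"
    using assms(3)[OF d] by simp
  then have "(l * bracket x i k p) * (l * bracket x j r p) * (l' * bracket y i r s) * (l' * bracket y j k s) =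
    (l * bracket x i r p) * (l * bracket x j k p) * (l' * bracket y i k s) * (l' * bracket y j r s)"
    by (simp only: ac_simps)
  then obtain m1 m2 m3 m4 where m: "m1 \<noteq> 0 \<or> m2 \<noteq> 0 \<or> m3 \<noteq> 0 \<or> m4 \<noteq> 0"
    "\<And>n. m1 * ((\<phi> \<odot> x (g n)) * (\<phi>' \<odot> y (g n))) + m2 * ((\<phi> \<odot> x (g n)) * (\<psi>' \<odot> y (g n)))
      + m3 * ((\<psi> \<odot> x (g n)) * (\<phi>' \<odot> y (g n))) + m4 * ((\<psi> \<odot> x (g n)) * (\<psi>' \<odot> y (g n))) = 0"
    using bilinear_form_through_four_points[of "\<lambda>n. \<phi> \<odot> x (g n)" "\<lambda>n. \<psi> \<odot> x (g n)" "\<lambda>n. \<phi>' \<odot> y (g n)" "\<lambda>n. \<psi>' \<odot> y (g n)"]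
    unfolding g bracket_def \<phi>(4) \<phi>'(4) by metis
  define M where "M = m1 *s (\<phi> \<otimes> \<phi>') + m2 *s (\<phi> \<otimes> \<psi>') + m3 *s (\<psi> \<otimes> \<phi>') + m4 *s (\<psi> \<otimes> \<psi>')"
  have M: "M \<odot> (u \<otimes> v) = m1 * ((\<phi> \<odot> u) * (\<phi>' \<odot> v)) + m2 * ((\<phi> \<odot> u) * (\<psi>' \<odot> v))
      + m3 * ((\<psi> \<odot> u) * (\<phi>' \<odot> v)) + m4 * ((\<psi> \<odot> u) * (\<psi>' \<odot> v))" for u v
    by (simp add: M_def scalar_product_add_left scalar_product_smult_left scalar_product_kronecker)
  have "M \<odot> (x n \<otimes> y n) = 0" for n
  proof -
    have "n \<in> {i, j, k, r, p, s}"
      using UNIV_6_if_distinct[OF d] by blast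
    then consider "n \<in> range g" | "n = p" | "n = s"
      using g by (metis insert_iff empty_iff rangeI)
    then show ?thesis
    proof cases
      case 1
      then show ?thesis
        using m(2) by (auto simp: M)
    qed (simp_all add: M \<phi>(1,2) \<phi>'(1,2))
  qed
  moreover have "M \<noteq> 0"
  proof
    assume "M = 0"
    then have *: "M \<odot> (u \<otimes> v) = 0" for u v
      by (simp add: scalar_product_zero_left)
    obtain u1 u2 v1 v2 where "\<phi> \<odot> u1 = 1" "\<psi> \<odot> u1 = 0" "\<phi> \<odot> u2 = 0" "\<psi> \<odot> u2 = 1"
      "\<phi>' \<odot> v1 = 1" "\<psi>' \<odot> v1 = 0" "\<phi>' \<odot> v2 = 0" "\<psi>' \<odot> v2 = 1"
      using \<phi>(5) \<phi>'(5) by metis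
    with *[of u1 v1] *[of u1 v2] *[of u2 v1] *[of u2 v2] m(1) show False
      by (simp add: M)
  qed
  moreover have "M \<odot> (x p \<otimes> v) = 0" "M \<odot> (u \<otimes> y s) = 0" for u v
    by (simp_all add: M \<phi>(1,2) \<phi>'(1,2))
  ultimately show "\<exists>m\<in>annihilator x y. m \<noteq> 0 \<and> (\<forall>v. m \<odot> (x p \<otimes> v) = 0) \<and> (\<forall>u. m \<odot> (u \<otimes> y s) = 0)"
    by (auto simp: annihilator_def)
qed

text \<open>
  Let \<open>N\<close> be the form for \<open>p\<close> and some \<open>s\<close>.  If \<open>N\<close> does not vanish at another \<open>y\<^sub>s\<close>, the form for
  that \<open>s\<close> is independent of \<open>N\<close>.  If \<open>N\<close> vanishes at all \<open>y\<^sub>s\<close> with \<open>s \<noteq> p\<close>, these lie on a line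
  \<open>b = 0\<close>, and then every product of \<open>b\<close> with a linear form vanishing at \<open>x\<^sub>p\<close> belongs to the
  annihilator; there are two independent ones.
\<close>

lemma two_independent_forms_vanishing_at:
  assumes "has_singular_forms x y" "\<not> in_a_line y" "x p \<noteq> 0" "q \<noteq> p"
  obtains m m' where "m \<in> annihilator x y" "m' \<in> annihilator x y"
    "\<And>v. m \<odot> (x p \<otimes> v) = 0" "\<And>v. m' \<odot> (x p \<otimes> v) = 0"
    "\<And>a b. a *s m + b *s m' = 0 \<Longrightarrow> a = 0 \<and> b = 0"
proof -
  obtain N where N: "N \<in> annihilator x y" "N \<noteq> 0" "\<And>v. N \<odot> (x p \<otimes> v) = 0"
    using assms(1,4) unfolding has_singular_forms_def by metis
  show thesis
  proof (cases "\<forall>s. s \<noteq> p \<longrightarrow> (\<forall>u. N \<odot> (u \<otimes> y s) = 0)")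
    case True
    have "\<exists>u. N \<odot> (u \<otimes> y p) \<noteq> 0"
    proof (rule ccontr)
      assume "\<not> ?thesis"
      with True have *: "contract_left N u \<odot> y s = 0" for u s
        unfolding scalar_product_contract_left by metis
      have "contract_left N u = 0" for u
        by (rule not_in_a_lineD[OF assms(2)]) (rule *)
      then have "N \<odot> (u \<otimes> v) = 0" for u v
        by (metis scalar_product_contract_left scalar_product_zero_left)
      then show False
        using N(2) eq_0_if_kills_kronecker by blast
    qed
    then obtain u where u: "N \<odot> (u \<otimes> y p) \<noteq> 0" ..
    define b where "b = contract_left N u"
    have b: "b \<odot> y p \<noteq> 0" "\<And>s. s \<noteq> p \<Longrightarrow> b \<odot> y s = 0"
      using u True by (auto simp: b_def scalar_product_contract_left)
    obtain \<phi> \<psi> :: "complex ^ 3" and l where \<phi>: "\<phi> \<odot> x p = 0" "\<psi> \<odot> x p = 0" "l \<noteq> 0"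
      "\<And>u v. (\<phi> \<odot> u) * (\<psi> \<odot> v) - (\<psi> \<odot> u) * (\<phi> \<odot> v) = l * det (vector [u, v, x p] :: complex ^ 3 ^ 3)"
      "\<And>a b. \<exists>u. \<phi> \<odot> u = a \<and> \<psi> \<odot> u = b"
      by (rule projection_from_point[OF assms(3)]) (rule that)
    show thesis
    proof (rule that[of "\<phi> \<otimes> b" "\<psi> \<otimes> b"])
      fix a c
      assume "a *s (\<phi> \<otimes> b) + c *s (\<psi> \<otimes> b) = 0"
      then have "(a *s (\<phi> \<otimes> b) + c *s (\<psi> \<otimes> b)) \<odot> (u \<otimes> y p) = 0" for u
        by (simp add: scalar_product_zero_left)
      then have *: "(a * (\<phi> \<odot> u) + c * (\<psi> \<odot> u)) * (b \<odot> y p) = 0" for u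
        by (simp add: scalar_product_add_left scalar_product_smult_left scalar_product_kronecker algebra_simps)
      obtain u1 u2 where "\<phi> \<odot> u1 = 1" "\<psi> \<odot> u1 = 0" "\<phi> \<odot> u2 = 0" "\<psi> \<odot> u2 = 1"
        using \<phi>(5) by metis
      with *[of u1] *[of u2] b(1) show "a = 0 \<and> c = 0"
        by simp
    next
      have "\<phi> \<odot> x i * (b \<odot> y i) = 0 \<and> \<psi> \<odot> x i * (b \<odot> y i) = 0" for i
        using \<phi>(1,2) b(2) by (cases "i = p") auto
      then show "\<phi> \<otimes> b \<in> annihilator x y" "\<psi> \<otimes> b \<in> annihilator x y"
        by (auto simp: annihilator_def scalar_product_kronecker)
    qed (simp_all add: scalar_product_kronecker \<phi>(1,2))
  next
    case False
    then obtain s u where s: "s \<noteq> p" "N \<odot> (u \<otimes> y s) \<noteq> 0"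
      by blast
    obtain N' where N': "N' \<in> annihilator x y" "N' \<noteq> 0" "\<And>v. N' \<odot> (x p \<otimes> v) = 0" "\<And>u. N' \<odot> (u \<otimes> y s) = 0"
      using assms(1) s(1) unfolding has_singular_forms_def by metis
    show thesis
    proof (rule that[OF N(1) N'(1) N(3) N'(3)])
      fix a b
      assume *: "a *s N + b *s N' = 0"
      then have "(a *s N + b *s N') \<odot> (u \<otimes> y s) = 0"
        by (simp add: scalar_product_zero_left)
      with s(2) have "a = 0"
        by (simp add: scalar_product_add_left scalar_product_smult_left N'(4))
      with * N'(2) show "a = 0 \<and> b = 0"
        by simp
    qed
  qed
qed

text \<open>
  In a space of dimension at most \<open>3\<close>, the span of \<open>m\<close> and \<open>m'\<close> meets the space, of dimension at
  least \<open>2\<close>, of the forms that vanish at \<open>x\<^sub>p\<close>.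
\<close>

lemma contractions_proportional:
  fixes x y :: "6 \<Rightarrow> complex ^ 3"
  assumes "has_singular_forms x y" "\<not> rows_dependent (Z_matrix x y) UNIV" "\<not> in_a_line y" "x p \<noteq> 0"
    and "m \<in> annihilator x y" "m' \<in> annihilator x y"
  obtains c d where "c \<noteq> 0 \<or> d \<noteq> 0" "\<And>v. c * (m \<odot> (x p \<otimes> v)) + d * (m' \<odot> (x p \<otimes> v)) = 0"
proof -
  have "p + 1 \<noteq> p"
    by simp
  then obtain n n' where n: "n \<in> annihilator x y" "n' \<in> annihilator x y"
    "\<And>v. n \<odot> (x p \<otimes> v) = 0" "\<And>v. n' \<odot> (x p \<otimes> v) = 0"
    "\<And>a b. a *s n + b *s n' = 0 \<Longrightarrow> a = 0 \<and> b = 0"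
    using two_independent_forms_vanishing_at[OF assms(1,3,4)] by metis
  obtain a b c d where abcd: "a \<noteq> 0 \<or> b \<noteq> 0 \<or> c \<noteq> 0 \<or> d \<noteq> 0" "a *s n + b *s n' + c *s m + d *s m' = 0"
    using four_forms_dependent[OF assms(2) n(1,2) assms(5,6)] by metis
  show thesis
  proof (rule that[of c d])
    show "c \<noteq> 0 \<or> d \<noteq> 0"
      using abcd n(5)[of a b] by auto
    show "c * (m \<odot> (x p \<otimes> v)) + d * (m' \<odot> (x p \<otimes> v)) = 0" for v
    proof -
      have "(a *s n + b *s n' + c *s m + d *s m') \<odot> (x p \<otimes> v) = 0"
        by (simp add: abcd(2) scalar_product_zero_left)
      then show ?thesis
        by (simp add: scalar_product_add_left scalar_product_smult_left n(3,4))
    qed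
  qed
qed

lemma annihilator_closed:
  assumes "m \<in> annihilator x y" "m' \<in> annihilator x y"
  shows "c *s m + d *s m' \<in> annihilator x y"
  using assms by (simp add: annihilator_def scalar_product_add_left scalar_product_smult_left)

text \<open>
  Two spaces of dimension at least \<open>2\<close> in a space of dimension at most \<open>3\<close> intersect: the
  proportionality at \<open>x\<^sub>q\<close> is applied to two independent forms that vanish at \<open>x\<^sub>p\<close>.
\<close>

lemma form_vanishing_at_two_points:
  fixes x y :: "6 \<Rightarrow> complex ^ 3"
  assumes "has_singular_forms x y" "\<not> rows_dependent (Z_matrix x y) UNIV" "\<not> in_a_line y"
    and "x p \<noteq> 0" "x q \<noteq> 0"
  obtains m where "m \<in> annihilator x y" "m \<noteq> 0"
    "\<And>v. m \<odot> (x p \<otimes> v) = 0" "\<And>v. m \<odot> (x q \<otimes> v) = 0"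
proof -
  have "p + 1 \<noteq> p"
    by simp
  then obtain n n' where n: "n \<in> annihilator x y" "n' \<in> annihilator x y"
    "\<And>v. n \<odot> (x p \<otimes> v) = 0" "\<And>v. n' \<odot> (x p \<otimes> v) = 0"
    "\<And>a b. a *s n + b *s n' = 0 \<Longrightarrow> a = 0 \<and> b = 0"
    using two_independent_forms_vanishing_at[OF assms(1,3,4)] by metis
  obtain c d where cd: "c \<noteq> 0 \<or> d \<noteq> 0" "\<And>v. c * (n \<odot> (x q \<otimes> v)) + d * (n' \<odot> (x q \<otimes> v)) = 0"
    using contractions_proportional[OF assms(1,2,3,5) n(1,2)] by metis
  show thesis
    using n cd by (intro that[of "c *s n + d *s n'"] annihilator_closed)
      (auto simp: scalar_product_add_left scalar_product_smult_left)
qed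

section \<open>The asymmetric double triangle\<close>

text \<open>
  The dual basis \<open>\<alpha>\<close> consists of the columns of the inverse of the matrix with rows \<open>x (e a)\<close>.
\<close>

lemma basis_of_points:
  fixes x :: "'i \<Rightarrow> complex ^ 3"
  assumes "\<And>i. x i \<noteq> 0" and "\<not> in_a_line x"
  obtains e :: "3 \<Rightarrow> 'i" and \<alpha> :: "3 \<Rightarrow> complex ^ 3"
  where "\<And>a b. \<alpha> a \<odot> x (e b) = (if a = b then 1 else 0)"
    "\<And>u. u = (\<Sum>a\<in>UNIV. (\<alpha> a \<odot> u) *s x (e a))"
proof -
  obtain i0 :: 'i where "True"
    by simp
  obtain \<phi> \<psi> :: "complex ^ 3" and l where \<phi>: "\<phi> \<odot> x i0 = 0" "\<psi> \<odot> x i0 = 0" "l \<noteq> 0"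
    "\<And>u v. (\<phi> \<odot> u) * (\<psi> \<odot> v) - (\<psi> \<odot> u) * (\<phi> \<odot> v) = l * det (vector [u, v, x i0] :: complex ^ 3 ^ 3)"
    "\<And>a b. \<exists>u. \<phi> \<odot> u = a \<and> \<psi> \<odot> u = b"
    by (rule projection_from_point[OF assms(1)[of i0]]) (rule that)
  have "\<phi> \<noteq> 0"
    using \<phi>(5)[of 1 0] by (auto simp: scalar_product_zero_left)
  then obtain i1 where i1: "\<phi> \<odot> x i1 \<noteq> 0"
    using not_in_a_lineD[OF assms(2)] by metis
  \<comment> \<open>The linear form that defines the line through \<open>x i0\<close> and \<open>x i1\<close>.\<close>
  define w where "w = (\<phi> \<odot> x i1) *s \<psi> - (\<psi> \<odot> x i1) *s \<phi>"
  have w: "w \<odot> u = l * det (vector [x i1, u, x i0] :: complex ^ 3 ^ 3)" for u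
    unfolding w_def scalar_product_diff_left scalar_product_smult_left \<phi>(4)[symmetric] by simp
  have "w \<noteq> 0"
  proof
    assume "w = 0"
    obtain u where "\<phi> \<odot> u = 0" "\<psi> \<odot> u = 1"
      using \<phi>(5) by metis
    then have "w \<odot> u = \<phi> \<odot> x i1"
      unfolding w_def scalar_product_diff_left scalar_product_smult_left by simp
    with i1 \<open>w = 0\<close> show False
      by (simp add: scalar_product_zero_left)
  qed
  then obtain i2 where "w \<odot> x i2 \<noteq> 0"
    using not_in_a_lineD[OF assms(2)] by metis
  then have det: "det (vector [x i1, x i2, x i0] :: complex ^ 3 ^ 3) \<noteq> 0"
    by (simp add: w)
  define e :: "3 \<Rightarrow> 'i" where "e a = (if a = 1 then i1 else if a = 2 then i2 else i0)" for a
  define X :: "complex ^ 3 ^ 3" where "X = (\<chi> a. x (e a))"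
  have "X = vector [x i1, x i2, x i0]"
    by (simp add: X_def vec_eq_iff forall_3 e_def)
  then obtain B where B: "X ** B = mat 1" "B ** X = mat 1"
    using det invertible_det_nz[of X] by (auto simp: invertible_def)
  define \<alpha> :: "3 \<Rightarrow> complex ^ 3" where "\<alpha> a = (\<chi> k. B $ k $ a)" for a
  show thesis
  proof (rule that[of \<alpha> e])
    fix a b
    have "\<alpha> a \<odot> x (e b) = (X ** B) $ b $ a"
      by (simp add: \<alpha>_def X_def scalar_product_def matrix_matrix_mult_def mult.commute)
    then show "\<alpha> a \<odot> x (e b) = (if a = b then 1 else 0)"
      by (simp add: B(1) mat_def)
  next
    fix u :: "complex ^ 3"
    have "u $ k = (\<Sum>a\<in>UNIV. (\<alpha> a \<odot> u) *s x (e a)) $ k" for k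
    proof -
      have "u $ k = (\<Sum>j\<in>UNIV. u $ j * (B ** X) $ j $ k)"
        by (simp add: B(2) mat_def if_distrib[of "\<lambda>t. _ * t"] cong: if_cong)
      also have "\<dots> = (\<Sum>j\<in>UNIV. \<Sum>a\<in>UNIV. u $ j * (B $ j $ a * x (e a) $ k))"
        by (simp add: X_def matrix_matrix_mult_def sum_distrib_left)
      also have "\<dots> = (\<Sum>a\<in>UNIV. \<Sum>j\<in>UNIV. u $ j * (B $ j $ a * x (e a) $ k))"
        by (rule sum.swap)
      also have "\<dots> = (\<Sum>a\<in>UNIV. (\<alpha> a \<odot> u) * x (e a) $ k)"
        by (simp add: \<alpha>_def scalar_product_def sum_distrib_left sum_distrib_right ac_simps)
      finally show ?thesis
        by simp
    qed
    then show "u = (\<Sum>a\<in>UNIV. (\<alpha> a \<odot> u) *s x (e a))"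
      unfolding vec_eq_iff by blast
  qed
qed

lemma proj_point_eq_iff:
  assumes "u \<noteq> 0"
  shows "proj_point u = proj_point v \<longleftrightarrow> (\<exists>k. k \<noteq> 0 \<and> u = k *s v)"
proof
  assume "proj_point u = proj_point v"
  then have "u \<in> vec.span {v}"
    unfolding proj_point_def using vec.span_base[of u "{u}"] by auto
  then show "\<exists>k. k \<noteq> 0 \<and> u = k *s v"
    using assms by (auto simp: vec.span_singleton)
next
  assume "\<exists>k. k \<noteq> 0 \<and> u = k *s v"
  then obtain k where k: "k \<noteq> 0" "u = k *s v"
    by auto
  then have "v = inverse k *s u"
    by simp
  then have "v \<in> vec.span {u}"
    unfolding vec.span_singleton by blast
  moreover have "u \<in> vec.span {v}"
    unfolding vec.span_singleton using k(2) by blast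
  ultimately show "proj_point u = proj_point v"
    unfolding proj_point_def vec.span_eq by simp
qed

lemma projectively_equal_pairs_dependent:
  fixes x y :: "'i::finite \<Rightarrow> complex ^ 3"
  assumes "i \<noteq> j" "x i = k *s x j" "y i = l *s y j"
  shows "rows_dependent (Z_matrix x y) UNIV"
proof -
  define c where "c n = (if n = i then 1 else if n = j then - (k * l) else 0)" for n
  have row: "row n (Z_matrix x y) = x n \<otimes> y n" for n
    by (simp add: row_def Z_matrix_def)
  have "(\<Sum>n\<in>UNIV. c n *s row n (Z_matrix x y)) = (\<Sum>n\<in>{i, j}. c n *s row n (Z_matrix x y))"
    by (rule sum.mono_neutral_right) (auto simp: c_def)
  also have "\<dots> = 0"
    using assms by (simp add: c_def row kronecker_vec_smult_left kronecker_vec_smult_right mult.commute)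
  finally show ?thesis
    unfolding rows_dependent_def by (intro exI[of _ c]) (auto simp: c_def)
qed

text \<open>
  The labels \<open>c i\<close> and \<open>d i\<close> are the unique \<open>a\<close> with \<open>\<alpha>\<^sub>a(x\<^sub>i) \<noteq> 0\<close> and the unique \<open>a\<close> with
  \<open>r\<^sub>a(y\<^sub>i) \<noteq> 0\<close>, where the rank-one forms \<open>\<alpha>\<^sub>a(u) r\<^sub>a(v)\<close> belong to the annihilator.
\<close>

lemma triangle_labels:
  fixes x y :: "6 \<Rightarrow> complex ^ 3"
  assumes x: "\<And>i. x i \<noteq> 0" and y: "\<And>i. y i \<noteq> 0"
    and lx: "\<not> in_a_line x" and ly: "\<not> in_a_line y"
    and indep: "\<not> rows_dependent (Z_matrix x y) UNIV"
    and sing: "has_singular_forms x y"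
  obtains c d :: "6 \<Rightarrow> 3" where "\<And>i. c i \<noteq> d i"
    "\<And>i j. proj_point (x i) = proj_point (x j) \<longleftrightarrow> c i = c j"
    "\<And>i j. proj_point (y i) = proj_point (y j) \<longleftrightarrow> d i = d j"
proof -
  obtain e :: "3 \<Rightarrow> 6" and \<alpha> :: "3 \<Rightarrow> complex ^ 3"
    where \<alpha>: "\<And>a b. \<alpha> a \<odot> x (e b) = (if a = b then 1 else 0)"
      and u: "\<And>u. u = (\<Sum>a\<in>UNIV. (\<alpha> a \<odot> u) *s x (e a))"
    by (rule basis_of_points[OF x lx]) (rule that)
  have "\<exists>m\<in>annihilator x y. m \<noteq> 0 \<and> (\<forall>b. b \<noteq> a \<longrightarrow> (\<forall>v. m \<odot> (x (e b) \<otimes> v) = 0))" for a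
  proof -
    obtain p q where "\<And>b. b \<noteq> a \<Longrightarrow> b = p \<or> b = q"
      by (metis exhaust_3)
    moreover obtain m where "m \<in> annihilator x y" "m \<noteq> 0"
      "\<And>v. m \<odot> (x (e p) \<otimes> v) = 0" "\<And>v. m \<odot> (x (e q) \<otimes> v) = 0"
      by (rule form_vanishing_at_two_points[OF sing indep ly x[of "e p"] x[of "e q"]]) (rule that)
    ultimately show ?thesis
      by (intro bexI[of _ m]) auto
  qed
  then obtain m where m: "\<And>a. m a \<in> annihilator x y" "\<And>a. m a \<noteq> 0"
    "\<And>a b v. b \<noteq> a \<Longrightarrow> m a \<odot> (x (e b) \<otimes> v) = 0"
    by metis
  define r where "r a = contract_left (m a) (x (e a))" for a
  have r: "m a \<odot> (z \<otimes> v) = (\<alpha> a \<odot> z) * (r a \<odot> v)" for a z v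
  proof -
    have "m a \<odot> (z \<otimes> v) = m a \<odot> ((\<Sum>b\<in>UNIV. (\<alpha> b \<odot> z) *s x (e b)) \<otimes> v)"
      by (simp flip: u)
    also have "\<dots> = (\<Sum>b\<in>UNIV. (\<alpha> b \<odot> z) * (m a \<odot> (x (e b) \<otimes> v)))"
      by (simp add: sum_3 kronecker_vec_add_left kronecker_vec_smult_left scalar_product_add_right
          scalar_product_smult_right)
    also have "\<dots> = (\<Sum>b\<in>UNIV. if b = a then (\<alpha> a \<odot> z) * (m a \<odot> (x (e a) \<otimes> v)) else 0)"
      by (rule sum.cong) (auto simp: m(3))
    finally show ?thesis
      by (simp add: r_def scalar_product_contract_left)
  qed
  have r0: "r a \<noteq> 0" for a
  proof
    assume "r a = 0"
    then have "m a \<odot> (z \<otimes> v) = 0" for z v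
      by (simp add: r scalar_product_zero_left)
    with m(2) show False
      using eq_0_if_kills_kronecker by blast
  qed
  have r_at: "\<exists>j. r a \<odot> y j \<noteq> 0" for a
    using not_in_a_lineD[OF ly] r0 by metis
  have ann: "\<alpha> a \<odot> x i = 0 \<or> r a \<odot> y i = 0" for a i
    using m(1)[of a] by (auto simp: annihilator_def r)
  \<comment> \<open>\<open>m a\<close> and \<open>m b\<close> contract at \<open>y i\<close> to multiples of the independent forms
    \<open>\<alpha> a\<close> and \<open>\<alpha> b\<close>; these are proportional, so one multiple is zero.\<close>
  have y_unique: "r a \<odot> y i = 0 \<or> r b \<odot> y i = 0" if "a \<noteq> b" for a b i
  proof -
    obtain c d where cd: "c \<noteq> 0 \<or> d \<noteq> 0"
      "\<And>z. c * (flip (m a) \<odot> (y i \<otimes> z)) + d * (flip (m b) \<odot> (y i \<otimes> z)) = 0"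
    proof (rule contractions_proportional)
      show "has_singular_forms y x"
        by (rule has_singular_forms_swap[OF sing])
      show "\<not> rows_dependent (Z_matrix y x) UNIV"
        using rows_dependent_swap[of y x] indep by blast
      show "flip (m a) \<in> annihilator y x" "flip (m b) \<in> annihilator y x"
        by (simp_all add: flip_in_annihilator_iff m(1))
    qed (rule lx y that)+
    show ?thesis
      using cd(1) cd(2)[of "x (e a)"] cd(2)[of "x (e b)"] that
      by (auto simp: scalar_product_flip r \<alpha>)
  qed
  \<comment> \<open>If both were nonzero, \<open>r a\<close> and \<open>r b\<close> would be proportional, so by \<open>y_unique\<close> both would
    vanish at all \<open>y j\<close>, which do not lie on a line.\<close>
  have x_unique: "\<alpha> a \<odot> x i = 0 \<or> \<alpha> b \<odot> x i = 0" if "a \<noteq> b" for a b i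
  proof (rule ccontr)
    assume neg: "\<not> ?thesis"
    obtain c d where cd: "c \<noteq> 0 \<or> d \<noteq> 0"
      "\<And>v. c * (m a \<odot> (x i \<otimes> v)) + d * (m b \<odot> (x i \<otimes> v)) = 0"
      by (rule contractions_proportional[OF sing indep ly x[of i] m(1)[of a] m(1)[of b]]) (rule that)
    obtain j j' where "r a \<odot> y j \<noteq> 0" "r b \<odot> y j' \<noteq> 0"
      using r_at by metis
    with cd(1) cd(2)[of "y j"] cd(2)[of "y j'"] neg y_unique[OF that, of j] y_unique[OF that, of j']
    show False
      by (auto simp: r)
  qed
  have "\<exists>a. \<alpha> a \<odot> x i \<noteq> 0" for i
  proof (rule ccontr)
    assume "\<not> ?thesis"
    then have "(\<Sum>a\<in>UNIV. (\<alpha> a \<odot> x i) *s x (e a)) = 0"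
      by simp
    with u[of "x i"] x[of i] show False
      by simp
  qed
  then obtain c where c: "\<And>i. \<alpha> (c i) \<odot> x i \<noteq> 0"
    by metis
  have c_eq: "\<alpha> a \<odot> x i \<noteq> 0 \<longleftrightarrow> a = c i" for a i
    using c x_unique by metis
  define R where "R = (\<chi> a. r a)"
  \<comment> \<open>The \<open>r a\<close> are independent: each is nonzero at some \<open>y j\<close>, where the other two vanish.\<close>
  have R_inj: "z = 0" if "\<And>a. r a \<odot> z = 0" for z
  proof -
    have "\<forall>f. (\<Sum>a\<in>UNIV. f a *s row a R) = 0 \<longrightarrow> (\<forall>a. f a = 0)"
    proof (intro allI impI)
      fix f a
      assume f: "(\<Sum>a\<in>UNIV. f a *s row a R) = 0"
      obtain j where j: "r a \<odot> y j \<noteq> 0"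
        using r_at by blast
      have "0 = (\<Sum>b\<in>UNIV. f b *s row b R) \<odot> y j"
        by (simp add: f scalar_product_zero_left)
      also have "\<dots> = (\<Sum>b\<in>UNIV. f b * (r b \<odot> y j))"
        by (simp add: sum_3 scalar_product_add_left scalar_product_smult_left R_def row_def)
      also have "\<dots> = (\<Sum>b\<in>UNIV. if b = a then f a * (r a \<odot> y j) else 0)"
        using j y_unique[of a _ j] by (intro sum.cong) auto
      finally show "f a = 0"
        using j by simp
    qed
    then obtain B where "R ** B = mat 1"
      unfolding matrix_right_invertible_independent_rows[symmetric] by (elim exE)
    then have "B ** R = mat 1"
      using matrix_left_right_inverse by blast
    moreover have "R *v z = 0"
      using that by (simp add: vec_eq_iff matrix_vector_mult_def R_def scalar_product_def)
    ultimately show ?thesis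
      by (metis matrix_left_invertible_ker)
  qed
  have "\<exists>a. r a \<odot> y i \<noteq> 0" for i
    using R_inj[of "y i"] y[of i] by blast
  then obtain d where d: "\<And>i. r (d i) \<odot> y i \<noteq> 0"
    by metis
  have d_eq: "r a \<odot> y i \<noteq> 0 \<longleftrightarrow> a = d i" for a i
    using d y_unique by metis
  show thesis
  proof (rule that[of c d])
    show "c i \<noteq> d i" for i
      using ann[of "c i" i] c d by metis
    show "proj_point (x i) = proj_point (x j) \<longleftrightarrow> c i = c j" for i j
    proof
      assume "proj_point (x i) = proj_point (x j)"
      then obtain k where "x i = k *s x j"
        using proj_point_eq_iff[OF x] by blast
      then have "\<alpha> (c i) \<odot> x j \<noteq> 0"
        using c[of i] by (auto simp: scalar_product_smult_right)
      then show "c i = c j"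
        by (simp add: c_eq)
    next
      assume eq: "c i = c j"
      have x_eq: "x n = (\<alpha> (c n) \<odot> x n) *s x (e (c n))" for n
      proof -
        have "x n = (\<Sum>a\<in>UNIV. if a = c n then (\<alpha> (c n) \<odot> x n) *s x (e (c n)) else 0)"
          using c_eq by (subst u[of "x n"], intro sum.cong) auto
        then show ?thesis
          by simp
      qed
      define k where "k = (\<alpha> (c i) \<odot> x i) / (\<alpha> (c j) \<odot> x j)"
      have k: "k \<noteq> 0" "k * (\<alpha> (c j) \<odot> x j) = \<alpha> (c i) \<odot> x i"
        using c[of i] c[of j] by (auto simp: k_def)
      have "x i = (k * (\<alpha> (c j) \<odot> x j)) *s x (e (c j))"
        using x_eq[of i] unfolding k(2) eq .
      also have "\<dots> = k *s ((\<alpha> (c j) \<odot> x j) *s x (e (c j)))"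
        by simp
      also have "\<dots> = k *s x j"
        by (simp flip: x_eq)
      finally show "proj_point (x i) = proj_point (x j)"
        using proj_point_eq_iff[OF x] k(1) by blast
    qed
    show "proj_point (y i) = proj_point (y j) \<longleftrightarrow> d i = d j" for i j
    proof
      assume "proj_point (y i) = proj_point (y j)"
      then obtain k where "y i = k *s y j"
        using proj_point_eq_iff[OF y] by blast
      then have "r (d i) \<odot> y j \<noteq> 0"
        using d[of i] by (auto simp: scalar_product_smult_right)
      then show "d i = d j"
        by (simp add: d_eq)
    next
      assume eq: "d i = d j"
      define k where "k = (r (d i) \<odot> y i) / (r (d i) \<odot> y j)"
      have k: "k \<noteq> 0" "k * (r (d i) \<odot> y j) = r (d i) \<odot> y i"
        using d[of i] d[of j] by (auto simp: k_def eq)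
      \<comment> \<open>The multiple of \<open>y j\<close> is chosen so that \<open>r (d i)\<close> vanishes on the difference; the other two
        forms vanish at both points.\<close>
      have "r a \<odot> (y i - k *s y j) = 0" for a
        using k(2) d_eq[of a i] d_eq[of a j] eq
        by (cases "a = d i") (simp_all add: scalar_product_diff_right scalar_product_smult_right)
      then have "y i - k *s y j = 0"
        by (rule R_inj)
      then have "y i = k *s y j"
        by simp
      with k(1) show "proj_point (y i) = proj_point (y j)"
        using proj_point_eq_iff[OF y] by blast
    qed
  qed
qed

text \<open>
  By counting, every pair \<open>(a, b)\<close> with \<open>a \<noteq> b\<close> is the pair of labels of exactly one index \<open>s a b\<close>.
\<close>

lemma asymmetric_double_triangle_if_labels:
  fixes x y :: "6 \<Rightarrow> complex ^ 3" and c d :: "6 \<Rightarrow> 3"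
  assumes cd: "\<And>i. c i \<noteq> d i" and inj: "\<And>i j. c i = c j \<Longrightarrow> d i = d j \<Longrightarrow> i = j"
    and x: "\<And>i j. proj_point (x i) = proj_point (x j) \<longleftrightarrow> c i = c j"
    and y: "\<And>i j. proj_point (y i) = proj_point (y j) \<longleftrightarrow> d i = d j"
  shows "asymmetric_double_triangle x y"
proof -
  let ?P = "{(1, 2), (1, 3), (2, 1), (2, 3), (3, 1), (3, 2)} :: (3 \<times> 3) set"
  have "(c i, d i) \<in> ?P" for i
    using cd[of i] exhaust_3[of "c i"] exhaust_3[of "d i"] by auto
  then have sub: "range (\<lambda>i. (c i, d i)) \<subseteq> ?P"
    by auto
  have "card (range (\<lambda>i. (c i, d i))) = card (UNIV :: 6 set)"
    by (rule card_image) (auto intro!: injI inj)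
  then have "range (\<lambda>i. (c i, d i)) = ?P"
    by (intro card_subset_eq sub) auto
  then have ex: "\<exists>i. c i = a \<and> d i = b" if "(a, b) \<in> ?P" for a b
    using that by (metis (mono_tags, lifting) image_iff prod.inject)
  define s where "s a b = (SOME i. c i = a \<and> d i = b)" for a b
  have s: "c (s a b) = a \<and> d (s a b) = b" if "(a, b) \<in> ?P" for a b
    unfolding s_def by (rule someI_ex) (rule ex[OF that])
  \<comment> \<open>The points shared by \<open>\<sigma> 1, \<sigma> 2\<close>, by \<open>\<sigma> 3, \<sigma> 4\<close> and by \<open>\<sigma> 5, \<sigma> 6\<close> on the \<open>y\<close>-side get the labels
    \<open>3, 2, 1\<close>, and those shared by \<open>\<sigma> 1, \<sigma> 4\<close>, by \<open>\<sigma> 2, \<sigma> 5\<close> and by \<open>\<sigma> 3, \<sigma> 6\<close> on the \<open>x\<close>-side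
    get the labels \<open>1, 2, 3\<close>.\<close>
  define \<sigma> :: "6 \<Rightarrow> 6" where "\<sigma> k =
    (if k = 1 then s 1 3 else if k = 2 then s 2 3 else if k = 3 then s 3 2
     else if k = 4 then s 1 2 else if k = 5 then s 2 1 else s 3 1)" for k
  have \<sigma>: "\<sigma> 1 = s 1 3" "\<sigma> 2 = s 2 3" "\<sigma> 3 = s 3 2" "\<sigma> 4 = s 1 2" "\<sigma> 5 = s 2 1" "\<sigma> 6 = s 3 1"
    by (simp_all add: \<sigma>_def)
  have "i \<in> range \<sigma>" for i
  proof -
    have "(c i, d i) \<in> ?P"
      using sub by blast
    moreover have "s (c i) (d i) = i"
      using s[of "c i" "d i"] calculation by (intro inj) auto
    ultimately have "i \<in> {s 1 2, s 1 3, s 2 1, s 2 3, s 3 1, s 3 2}"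
      by (auto simp del: num1_eq1)
    then show ?thesis
      using \<sigma> by (metis insert_iff empty_iff rangeI)
  qed
  then have "surj \<sigma>"
    by blast
  then have "bij \<sigma>"
    using finite_UNIV_surj_inj[OF finite] by (simp add: bij_def)
  have card: "card (range f) = 3" if "\<And>i j. f i = f j \<longleftrightarrow> g i = g j" "surj g"
    for f :: "6 \<Rightarrow> (complex ^ 3) set" and g :: "6 \<Rightarrow> 3"
  proof -
    have inv: "g (inv g a) = a" for a
      by (rule surj_f_inv_f[OF that(2)])
    then have "range f = range (\<lambda>a. f (inv g a))"
      using that(1) by (auto simp: image_iff)
    moreover have "inj (\<lambda>a. f (inv g a))"
    proof (rule injI)
      fix a b
      assume "f (inv g a) = f (inv g b)"
      then show "a = b"
        unfolding that(1) inv .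
    qed
    ultimately show ?thesis
      by (simp add: card_image)
  qed
  have "surj c"
  proof (rule surjI)
    show "c (if a = 1 then s 1 2 else if a = 2 then s 2 1 else s 3 1) = a" for a
      using exhaust_3[of a] s by auto
  qed
  moreover have "surj d"
  proof (rule surjI)
    show "d (if a = 1 then s 2 1 else if a = 2 then s 1 2 else s 1 3) = a" for a
      using exhaust_3[of a] s by auto
  qed
  ultimately have "card (range (\<lambda>i. proj_point (x i))) = 3" "card (range (\<lambda>i. proj_point (y i))) = 3"
    using card[of "\<lambda>i. proj_point (x i)" c] card[of "\<lambda>i. proj_point (y i)" d] x y by auto
  with \<open>bij \<sigma>\<close> show ?thesis
    unfolding asymmetric_double_triangle_def
    by (intro conjI exI[of _ \<sigma>]) (simp_all add: x y \<sigma> s)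
qed

section \<open>Bracket equations and rank\<close>

lemma rows_dependent_superset:
  fixes A :: "'a::field ^ 'n ^ 'm"
  assumes "rows_dependent A I"
  shows "rows_dependent A UNIV"
proof -
  obtain c j where c: "j \<in> I" "c j \<noteq> 0" "(\<Sum>i\<in>I. c i *s row i A) = 0"
    using assms by (auto simp: rows_dependent_def)
  have "(\<Sum>i\<in>UNIV. (if i \<in> I then c i else 0) *s row i A) = (\<Sum>i\<in>I. c i *s row i A)"
    by (rule sum.mono_neutral_cong_right) auto
  with c show ?thesis
    unfolding rows_dependent_def by (intro exI[of _ "\<lambda>i. if i \<in> I then c i else 0"]) auto
qed

text \<open>
  The witness is the cross product of \<open>u\<close> and \<open>v\<close>.
\<close>

lemma det_eq_scalar_product:
  fixes u v :: "complex ^ 3"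
  obtains w where "\<And>z. det (vector [u, v, z] :: complex ^ 3 ^ 3) = w \<odot> z"
  by (rule that[of "vector [u $ 2 * v $ 3 - u $ 3 * v $ 2, u $ 3 * v $ 1 - u $ 1 * v $ 3, u $ 1 * v $ 2 - u $ 2 * v $ 1]"])
    (simp add: det_3 scalar_product_3 algebra_simps)

lemma bracket_alternating:
  "bracket x i i l = 0" "bracket x i l l = 0" "bracket x l i l = 0"
  "bracket x i l j = - bracket x i j l"
  by (simp_all add: bracket_def det_3 algebra_simps)

text \<open>
  The relation is paired with the product of the linear forms \<open>[x\<^sub>a x\<^sub>p _]\<close> and \<open>[y\<^sub>b y\<^sub>s _]\<close>, which
  vanishes at the pairs \<open>a, p, b, s\<close>.
\<close>

lemma two_term_relation:
  fixes x y :: "6 \<Rightarrow> complex ^ 3"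
  assumes c: "(\<Sum>i\<in>UNIV. c i *s row i (Z_matrix x y)) = 0"
    and d: "distinct [a, b, k, r, p, s]"
  shows "c k * (bracket x a k p * bracket y b k s) + c r * (bracket x a r p * bracket y b r s) = 0"
proof -
  obtain w where w: "\<And>z. det (vector [x a, x p, z] :: complex ^ 3 ^ 3) = w \<odot> z"
    by (rule det_eq_scalar_product) (rule that)
  obtain w' where w': "\<And>z. det (vector [y b, y s, z] :: complex ^ 3 ^ 3) = w' \<odot> z"
    by (rule det_eq_scalar_product) (rule that)
  have UNIV: "UNIV = {a, b, k, r, p, s}"
    by (rule UNIV_6_if_distinct[OF d])
  have "(w \<otimes> w') \<odot> (\<Sum>i\<in>UNIV. c i *s row i (Z_matrix x y)) =
      (\<Sum>i\<in>UNIV. c i * (bracket x a p i * bracket y b s i))"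
    unfolding UNIV using d
    by (simp add: scalar_product_add_right scalar_product_smult_right row_def Z_matrix_def
        scalar_product_kronecker bracket_def w w')
  also have "\<dots> = c k * (bracket x a p k * bracket y b s k) + c r * (bracket x a p r * bracket y b s r)"
    unfolding UNIV using d by (simp add: bracket_alternating(1-3))
  finally show ?thesis
    using bracket_alternating(4)[of x a p] bracket_alternating(4)[of y b s]
    by (simp add: c scalar_product_def)
qed

text \<open>
  The relations for \<open>(a, b) = (i, j)\<close> and \<open>(a, b) = (j, i)\<close> form a homogeneous \<open>2 \<times> 2\<close> system for
  \<open>c k\<close> and \<open>c r\<close>; the bracket equation is the vanishing of its determinant.
\<close>

lemma bracket_equation_if_circuit:
  fixes x y :: "6 \<Rightarrow> complex ^ 3"
  assumes c: "(\<Sum>i\<in>UNIV. c i *s row i (Z_matrix x y)) = 0" and "c k \<noteq> 0"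
    and d: "distinct [i, j, k, r, p, s]"
  shows "bracket x i k p * bracket x j r p * bracket y i r s * bracket y j k s =
    bracket x i r p * bracket x j k p * bracket y i k s * bracket y j r s"
proof -
  have "c k * (bracket x i k p * bracket y j k s) = - (c r * (bracket x i r p * bracket y j r s))"
    using two_term_relation[OF c d] by (simp add: add_eq_0_iff2)
  moreover have "distinct [j, i, k, r, p, s]"
    using d by auto
  then have "c k * (bracket x j k p * bracket y i k s) = - (c r * (bracket x j r p * bracket y i r s))"
    using two_term_relation[OF c] by (simp add: add_eq_0_iff2)
  ultimately have "c k * (bracket x i k p * bracket y j k s) * (bracket x j r p * bracket y i r s) =
    c k * (bracket x j k p * bracket y i k s) * (bracket x i r p * bracket y j r s)"
    by simp
  then show ?thesis
    using \<open>c k \<noteq> 0\<close> by (simp add: ac_simps)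
qed

theorem theorem6p5:
  fixes x y :: "6 \<Rightarrow> complex ^ 3"
  assumes "\<And>i. x i \<noteq> 0" and "\<And>i. y i \<noteq> 0"
    and "\<not> in_a_line x" and "\<not> in_a_line y"
    and "\<not> asymmetric_double_triangle x y"
  shows "rank (Z_matrix x y) < 6 \<longleftrightarrow>
    inherited_condition (Z_matrix x y) \<or>
    (\<forall>i j k r p s. distinct [i, j, k, r, p, s] \<longrightarrow>
       bracket x i k p * bracket x j r p * bracket y i r s * bracket y j k s =
       bracket x i r p * bracket x j k p * bracket y i k s * bracket y j r s)"
    (is "_ \<longleftrightarrow> _ \<or> ?brackets")
proof -
  have rank: "rank (Z_matrix x y) < 6 \<longleftrightarrow> rows_dependent (Z_matrix x y) UNIV"
    using rank_less_iff_rows_dependent[of "Z_matrix x y"] by simp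
  show ?thesis
    unfolding rank
  proof (intro iffI; (elim disjE)?)
    assume "rows_dependent (Z_matrix x y) UNIV"
    then obtain c n where c: "c n \<noteq> 0" "(\<Sum>i\<in>UNIV. c i *s row i (Z_matrix x y)) = 0"
      by (auto simp: rows_dependent_def)
    show "inherited_condition (Z_matrix x y) \<or> ?brackets"
    proof (cases "\<exists>k. c k = 0")
      case True
      then obtain k where k: "c k = 0" ..
      have "(\<Sum>i\<in>UNIV - {k}. c i *s row i (Z_matrix x y)) = (\<Sum>i\<in>UNIV. c i *s row i (Z_matrix x y))"
        by (rule sum.mono_neutral_left) (auto simp: k)
      then have "rows_dependent (Z_matrix x y) (UNIV - {k})"
        unfolding rows_dependent_def using c k by (intro exI[of _ c]) auto
      then show ?thesis
        unfolding inherited_condition_def by (intro disjI1 exI[of _ "UNIV - {k}"]) auto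
    next
      case False
      then show ?thesis
        using bracket_equation_if_circuit[OF c(2)] by blast
    qed
  next
    assume "inherited_condition (Z_matrix x y)"
    then show "rows_dependent (Z_matrix x y) UNIV"
      unfolding inherited_condition_def using rows_dependent_superset by blast
  next
    assume brackets: ?brackets
    show "rows_dependent (Z_matrix x y) UNIV"
    proof (rule ccontr)
      assume indep: "\<not> rows_dependent (Z_matrix x y) UNIV"
      have "has_singular_forms x y"
        by (rule has_singular_forms_if_bracket_equations[OF assms(1,2)]) (use brackets in blast)
      then obtain c d :: "6 \<Rightarrow> 3" where cd: "\<And>i. c i \<noteq> d i"
        "\<And>i j. proj_point (x i) = proj_point (x j) \<longleftrightarrow> c i = c j"
        "\<And>i j. proj_point (y i) = proj_point (y j) \<longleftrightarrow> d i = d j"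
        by (rule triangle_labels[OF assms(1-4) indep]) (rule that)
      have "i = j" if "c i = c j" "d i = d j" for i j
        using that projectively_equal_pairs_dependent[of i j x _ y] indep
        unfolding cd(2,3)[symmetric] proj_point_eq_iff[OF assms(1)] proj_point_eq_iff[OF assms(2)]
        by blast
      then have "asymmetric_double_triangle x y"
        using asymmetric_double_triangle_if_labels[of c d x y] cd by blast
      with assms(5) show False
        by blast
    qed
  qed
qed

end
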